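(* Let $f:\mathbb H^+\to\mathbb H^+$ be a slice regular function and set $$c:=\inf\bigg\{\frac{\mathrm{Re}f(q)}{\mathrm{Re}(q)}:q\in\mathbb H^+\bigg\}\geq0.$$ Then the following hold true: (i) for any $q\in\mathbb H^+$, $\mathrm{Re}f(q)\geq c\,\mathrm{Re}(q)$; (ii) for any $\gamma\in(0,1)$, $$\lim_{\substack{|q|\to\infty\\ q\in\mathcal S_\gamma}}q^{-1}f(q)=\lim_{\substack{|q|\to\infty\\ q\in\mathcal S_\gamma}}\frac{\mathrm{Re}f(q)}{\mathrm{Re}(q)}=c;$$ (iii) for any $\gamma\in(0,1)$, $$\lim_{\substack{|q|\to\infty\\ q\in\mathcal S_\gamma}}f'(q)=c.$$
   Context: $\mathbb H$ is the algebra of quaternions, $\mathbb H^+=\{q\in\mathbb H:\mathrm{Re}(q)>0\}$, $\mathbb S=\{q\in\mathbb H:q^2=-1\}$, and $\mathbb C_I=\mathbb R\oplus I\mathbb R$ for $I\in\mathbb S$. A function $f$ on a domain $\Omega\subseteq\mathbb H$ is slice regular if for every $I\in\mathbb S$ its restriction $f_I$ to $\Omega\cap\mathbb C_I$ has continuous partial derivatives and satisfies $\frac12\left(\frac{\partial}{\partial x}+I\frac{\partial}{\partial y}\right)f_I(x+yI)=0$. The slice derivative is $f'(x+yI)=\frac12\left(\frac{\partial}{\partial x}-I\frac{\partial}{\partial y}\right)f_I(x+yI)$. For $\gamma\in(0,1)$, $\mathcal S_\gamma=\{q\in\mathbb H^+:\mathrm{Re}(q)>\gamma|q|\}$. *)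

theory Defs
  imports "HOL-Analysis.Analysis"
begin

datatype quat = Quat (qRe: real) (qI: real) (qJ: real) (qK: real)

lemma quat_eq_iff: "p = q \<longleftrightarrow> qRe p = qRe q \<and> qI p = qI q \<and> qJ p = qJ q \<and> qK p = qK q"
  by (auto intro: quat.expand)

lemmas quat_eqI = quat_eq_iff [THEN iffD2]

instantiation quat :: real_vector
begin

definition "0 = Quat 0 0 0 0"

definition "p + q = Quat (qRe p + qRe q) (qI p + qI q) (qJ p + qJ q) (qK p + qK q)"

definition "p - q = Quat (qRe p - qRe q) (qI p - qI q) (qJ p - qJ q) (qK p - qK q)"

definition "- q = Quat (- qRe q) (- qI q) (- qJ q) (- qK q)" for q :: quat

definition "r *\<^sub>R q = Quat (r * qRe q) (r * qI q) (r * qJ q) (r * qK q)"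

instance
  by standard
    (simp_all add: zero_quat_def plus_quat_def minus_quat_def uminus_quat_def scaleR_quat_def
      algebra_simps)

end

lemma quat_sel_zero [simp]: "qRe 0 = 0" "qI 0 = 0" "qJ 0 = 0" "qK 0 = 0"
  by (simp_all add: zero_quat_def)

lemma quat_sel_add [simp]:
  "qRe (p + q) = qRe p + qRe q" "qI (p + q) = qI p + qI q"
  "qJ (p + q) = qJ p + qJ q" "qK (p + q) = qK p + qK q"
  by (simp_all add: plus_quat_def)

lemma quat_sel_diff [simp]:
  "qRe (p - q) = qRe p - qRe q" "qI (p - q) = qI p - qI q"
  "qJ (p - q) = qJ p - qJ q" "qK (p - q) = qK p - qK q"
  by (simp_all add: minus_quat_def)

lemma quat_sel_uminus [simp]:
  "qRe (- q) = - qRe q" "qI (- q) = - qI q" "qJ (- q) = - qJ q" "qK (- q) = - qK q"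
  by (simp_all add: uminus_quat_def)

lemma quat_sel_scaleR [simp]:
  "qRe (r *\<^sub>R q) = r * qRe q" "qI (r *\<^sub>R q) = r * qI q"
  "qJ (r *\<^sub>R q) = r * qJ q" "qK (r *\<^sub>R q) = r * qK q"
  by (simp_all add: scaleR_quat_def)

instantiation quat :: real_inner
begin

definition "inner p q = qRe p * qRe q + qI p * qI q + qJ p * qJ q + qK p * qK q"

definition "norm q = sqrt ((qRe q)\<^sup>2 + (qI q)\<^sup>2 + (qJ q)\<^sup>2 + (qK q)\<^sup>2)"

definition "sgn q = q /\<^sub>R norm q" for q :: quat

definition "dist p q = norm (p - q)" for p q :: quat

definition [code del]:
  "(uniformity :: (quat \<times> quat) filter) = (INF e\<in>{0 <..}. principal {(x, y). dist x y < e})"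

definition [code del]:
  "open (U :: quat set) \<longleftrightarrow> (\<forall>x\<in>U. eventually (\<lambda>(x', y). x' = x \<longrightarrow> y \<in> U) uniformity)"

instance
proof
  fix p q r :: quat and a :: real and U :: "quat set"
  show "dist p q = norm (p - q)" by (rule dist_quat_def)
  show "sgn q = q /\<^sub>R norm q" by (rule sgn_quat_def)
  show "(uniformity :: (quat \<times> quat) filter) = (INF e\<in>{0 <..}. principal {(x, y). dist x y < e})"
    by (rule uniformity_quat_def)
  show "open U \<longleftrightarrow> (\<forall>x\<in>U. eventually (\<lambda>(x', y). x' = x \<longrightarrow> y \<in> U) uniformity)"
    by (rule open_quat_def)
  show "inner p q = inner q p" by (simp add: inner_quat_def mult.commute)
  show "inner (p + q) r = inner p r + inner q r" by (simp add: inner_quat_def algebra_simps)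
  show "inner (a *\<^sub>R p) q = a * inner p q" by (simp add: inner_quat_def algebra_simps)
  show "0 \<le> inner p p" by (simp add: inner_quat_def)
  show "inner p p = 0 \<longleftrightarrow> p = 0"
    by (simp add: inner_quat_def quat_eq_iff add_nonneg_eq_0_iff)
  show "norm p = sqrt (inner p p)" by (simp add: inner_quat_def norm_quat_def power2_eq_square)
qed

end

instantiation quat :: real_normed_div_algebra
begin

definition "1 = Quat 1 0 0 0"

definition "p * q = Quat
  (qRe p * qRe q - qI p * qI q - qJ p * qJ q - qK p * qK q)
  (qRe p * qI q + qI p * qRe q + qJ p * qK q - qK p * qJ q)
  (qRe p * qJ q - qI p * qK q + qJ p * qRe q + qK p * qI q)
  (qRe p * qK q + qI p * qJ q - qJ p * qI q + qK p * qRe q)"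

definition "inverse q = Quat (qRe q) (- qI q) (- qJ q) (- qK q) /\<^sub>R (norm q)\<^sup>2"

definition "p div q = p * inverse q" for p q :: quat

instance
proof
  fix p q r :: quat and a :: real
  have norm2: "(norm x)\<^sup>2 = (qRe x)\<^sup>2 + (qI x)\<^sup>2 + (qJ x)\<^sup>2 + (qK x)\<^sup>2" for x :: quat
    by (simp add: norm_quat_def)
  show "(p * q) * r = p * (q * r)" by (simp add: times_quat_def algebra_simps)
  show "1 * p = p" "p * 1 = p" by (simp_all add: times_quat_def one_quat_def)
  show "(p + q) * r = p * r + q * r" "p * (q + r) = p * q + p * r"
    by (simp_all add: times_quat_def plus_quat_def algebra_simps)
  show "(0 :: quat) \<noteq> 1" by (simp add: zero_quat_def one_quat_def)
  have scaleR_times: "a *\<^sub>R x * y = a *\<^sub>R (x * y)" "x * a *\<^sub>R y = a *\<^sub>R (x * y)"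
    for a and x y :: quat
    by (simp_all add: times_quat_def scaleR_quat_def algebra_simps)
  show "a *\<^sub>R p * q = a *\<^sub>R (p * q)" "p * a *\<^sub>R q = a *\<^sub>R (p * q)"
    by (rule scaleR_times)+
  show "p div q = p * inverse q" by (rule divide_quat_def)
  show "inverse (0 :: quat) = 0" by (simp add: inverse_quat_def)
  let ?cp = "Quat (qRe p) (- qI p) (- qJ p) (- qK p)"
  have conj_mult: "?cp * p = (norm p)\<^sup>2 *\<^sub>R 1" "p * ?cp = (norm p)\<^sup>2 *\<^sub>R 1"
    unfolding norm2 by (simp_all add: quat_eq_iff times_quat_def one_quat_def power2_eq_square)
  show "inverse p * p = 1" "p * inverse p = 1" if "p \<noteq> 0"
    using that by (simp_all add: inverse_quat_def scaleR_times conj_mult)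
  have "(norm (p * q))\<^sup>2 = (norm p * norm q)\<^sup>2"
    unfolding power_mult_distrib norm2
    by (simp add: times_quat_def power2_eq_square algebra_simps)
  then show "norm (p * q) = norm p * norm q" by simp
qed

end

lemma quat_sel_one [simp]: "qRe 1 = 1" "qI 1 = 0" "qJ 1 = 0" "qK 1 = 0"
  by (simp_all add: one_quat_def)

lemma quat_sel_mult [simp]:
  "qRe (p * q) = qRe p * qRe q - qI p * qI q - qJ p * qJ q - qK p * qK q"
  "qI (p * q) = qRe p * qI q + qI p * qRe q + qJ p * qK q - qK p * qJ q"
  "qJ (p * q) = qRe p * qJ q - qI p * qK q + qJ p * qRe q + qK p * qI q"
  "qK (p * q) = qRe p * qK q + qI p * qJ q - qJ p * qI q + qK p * qRe q"
  by (simp_all add: times_quat_def)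

lemma quat_sel_of_real [simp]:
  "qRe (of_real r) = r" "qI (of_real r) = 0" "qJ (of_real r) = 0" "qK (of_real r) = 0"
  by (simp_all add: of_real_def)

instantiation quat :: euclidean_space
begin

definition "Basis = {Quat 1 0 0 0, Quat 0 1 0 0, Quat 0 0 1 0, Quat 0 0 0 1}"

instance
proof
  fix u v q :: quat
  show "(Basis :: quat set) \<noteq> {}" "finite (Basis :: quat set)"
    by (simp_all add: Basis_quat_def)
  show "inner u v = (if u = v then 1 else 0)" if "u \<in> Basis" "v \<in> Basis"
    using that unfolding Basis_quat_def by (elim insertE emptyE) (simp_all add: inner_quat_def)
  show "(\<forall>u\<in>Basis. inner q u = 0) \<longleftrightarrow> q = 0"
    unfolding quat_eq_iff by (simp add: Basis_quat_def inner_quat_def)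
qed

end

definition imag_units :: "quat set" where
  "imag_units = {q. q\<^sup>2 = - 1}"

definition slice_point :: "quat \<Rightarrow> real \<Rightarrow> real \<Rightarrow> quat" where
  "slice_point I x y = of_real x + of_real y * I"

definition slice_dx :: "(quat \<Rightarrow> quat) \<Rightarrow> quat \<Rightarrow> real \<Rightarrow> real \<Rightarrow> quat" where
  "slice_dx f I x y = vector_derivative (\<lambda>t. f (slice_point I t y)) (at x)"

definition slice_dy :: "(quat \<Rightarrow> quat) \<Rightarrow> quat \<Rightarrow> real \<Rightarrow> real \<Rightarrow> quat" where
  "slice_dy f I x y = vector_derivative (\<lambda>t. f (slice_point I x t)) (at y)"

text \<open>
  Intended for open \<open>\<Omega>\<close>, where the two-sided partial derivatives depend only on the values of
  \<open>f\<close> on \<open>\<Omega>\<close>. Differentiability is required explicitly because \<^const>\<open>vector_derivative\<close> is total.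
\<close>

definition slice_regular_on :: "quat set \<Rightarrow> (quat \<Rightarrow> quat) \<Rightarrow> bool" where
  "slice_regular_on \<Omega> f \<longleftrightarrow> (\<forall>I\<in>imag_units.
     (\<forall>x y. slice_point I x y \<in> \<Omega> \<longrightarrow>
        (\<lambda>t. f (slice_point I t y)) differentiable (at x) \<and>
        (\<lambda>t. f (slice_point I x t)) differentiable (at y)) \<and>
     continuous_on {(x, y). slice_point I x y \<in> \<Omega>} (\<lambda>(x, y). slice_dx f I x y) \<and>
     continuous_on {(x, y). slice_point I x y \<in> \<Omega>} (\<lambda>(x, y). slice_dy f I x y) \<and>
     (\<forall>x y. slice_point I x y \<in> \<Omega> \<longrightarrow>
        (1 / 2) *\<^sub>R (slice_dx f I x y + I * slice_dy f I x y) = 0))"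

text \<open>
  The value is unique when \<open>f\<close> is slice regular near \<open>q\<close>: for non-real \<open>q\<close> the only other
  representation of \<open>x + y I\<close> is \<open>x + (- y) (- I)\<close>, which gives the same expression, and for
  real \<open>q\<close> the expression equals the derivative along the real axis for every \<open>I\<close>.
\<close>

definition slice_deriv :: "(quat \<Rightarrow> quat) \<Rightarrow> quat \<Rightarrow> quat" where
  "slice_deriv f q = (THE d. \<forall>I\<in>imag_units. \<forall>x y. q = slice_point I x y \<longrightarrow>
     d = (1 / 2) *\<^sub>R (slice_dx f I x y - I * slice_dy f I x y))"

definition right_half_space :: "quat set" where
  "right_half_space = {q. qRe q > 0}"

definition sector :: "real \<Rightarrow> quat set" where
  "sector \<gamma> = {q \<in> right_half_space. qRe q > \<gamma> * norm q}"

definition sector_at_infinity :: "real \<Rightarrow> quat filter" where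
  "sector_at_infinity \<gamma> = inf at_infinity (principal (sector \<gamma>))"

end

theory Submission
  imports Defs "HOL-Complex_Analysis.Conformal_Mappings"
begin

text \<open>
  This is a quaternionic Julia-Wolff-Caratheodory theorem for the point at infinity of the half-space.
  Write \<open>u(x) = Re f(x) - c x\<close> for real \<open>x > 0\<close>. The proof shows that \<open>u(x) / x\<close> tends to \<open>0\<close> and that
  this single function of a real variable controls \<open>f' - c\<close> in the whole sector.

  On a slice, \<open>f\<close> followed by \<open>q \<mapsto> Re q + \<i> \<langle>q, I\<rangle>\<close> is holomorphic on the right half-plane. After
  subtracting \<open>c z\<close> its real part is \<open>Re f(q) - c Re q \<ge> 0\<close>, and the Schwarz-Pick inequality gives a
  Harnack inequality and the derivative bound \<open>|\<psi>'(z)| \<le> Re \<psi>(z) / Re z\<close>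
  (\<open>Harnack_half_plane\<close>, \<open>deriv_bound_half_plane\<close>). Start from a point where \<open>Re f(q) / Re q\<close> is close to
  the infimum \<open>c\<close>. Harnack's inequality on its slice forces \<open>u(x) / x \<longlongrightarrow> 0\<close> on the real axis
  (\<open>excess_ratio_on_axis_tendsto_0\<close>). The real axis belongs to all slices; so Harnack's
  inequality, now used on an arbitrary slice from \<open>x = Re z\<close> to \<open>z\<close>, bounds \<open>|\<psi>'(z)|\<close> in the sector by a
  constant times \<open>u(x) / x\<close>, uniformly over the slices (\<open>deriv_slice_component_bound\<close>).

  This controls only one of the two complex components of \<open>f'\<close> on a slice. The other one is recovered
  from different slices: the four real components of \<open>f\<close> on the real axis have holomorphic extensions
  built from the controlled components on the slices of the three standard units, and by the identity
  theorem these extensions determine \<open>f\<close> on every slice (\<open>slice_dx_stem_expansion\<close>). Hence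
  \<open>|f'(q) - c|\<close> is at most a constant times \<open>u(Re q) / Re q\<close> in the sector, which is the limit of the
  derivative. Integrating from a real base point gives \<open>f(q) - c q = o(|q|)\<close>, hence the limit of
  \<open>q\<^sup>-\<^sup>1 f(q)\<close>; and since \<open>|q|\<close> and \<open>Re q\<close> are comparable in the sector, also that of \<open>Re f(q) / Re q\<close>.
\<close>

section \<open>Schwarz-Pick and Harnack inequalities in the right half-plane\<close>

text \<open>
  For points \<open>a\<close>, \<open>b\<close> of the right half-plane, \<open>a \<mapsto> (a - b) / (a + cnj b)\<close> is the Cayley map onto the
  unit disc sending \<open>b\<close> to \<open>0\<close>. This identity is the source of every half-plane estimate below: it
  says by how much the modulus of that quotient falls short of one.
\<close>

lemma norm_reflect_diff:
  "(norm (a + cnj b))\<^sup>2 - (norm (a - b))\<^sup>2 = 4 * Re a * Re b"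
  unfolding cmod_power2 by (simp add: power2_eq_square algebra_simps)

lemma norm_diff_less_reflect:
  assumes "Re a > 0" "Re b > 0"
  shows "norm (a - b) < norm (a + cnj b)"
proof (rule power2_less_imp_less)
  show "(norm (a - b))\<^sup>2 < (norm (a + cnj b))\<^sup>2"
    using norm_reflect_diff[of a b] assms by (smt (verit) mult_pos_pos)
qed simp

lemma half_plane_add_cnj_nonzero:
  assumes "Re a > 0" "Re b > 0"
  shows "a + cnj b \<noteq> 0"
  using assms by (auto simp: complex_eq_iff)

text \<open>
  Conjugating \<open>f\<close> with the Cayley maps centred at \<open>w\<close> and at \<open>f w\<close> produces a self-map of the disc
  that fixes \<open>0\<close>, to which the Schwarz lemma applies. The quotients are multiplied out, so that the
  inequality passes to limits of \<open>f\<close> whose values touch the imaginary axis.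
\<close>

lemma Schwarz_Pick_half_plane_strict:
  assumes hol: "f holomorphic_on {z. Re z > 0}"
    and pos: "\<And>z. Re z > 0 \<Longrightarrow> Re (f z) > 0"
    and z: "Re z > 0" and w: "Re w > 0"
  shows "norm (f z - f w) * norm (z + cnj w) \<le> norm (z - w) * norm (f z + cnj (f w))"
proof -
  \<comment> \<open>\<open>M\<close> is the inverse of the Cayley map centred at \<open>w\<close>, and \<open>\<zeta>0\<close> is the point that it sends to \<open>z\<close>.\<close>
  define M where "M \<zeta> = (w + cnj w * \<zeta>) / (1 - \<zeta>)" for \<zeta>
  define g where "g \<zeta> = (f (M \<zeta>) - f w) / (f (M \<zeta>) + cnj (f w))" for \<zeta>
  define \<zeta>0 where "\<zeta>0 = (z - w) / (z + cnj w)"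
  have zw: "z + cnj w \<noteq> 0" using z w by (rule half_plane_add_cnj_nonzero)
  have M0: "M 0 = w" by (simp add: M_def)
  have "1 - \<zeta>0 = (w + cnj w) / (z + cnj w)" "w + cnj w * \<zeta>0 = z * (w + cnj w) / (z + cnj w)"
    using zw by (simp_all add: \<zeta>0_def field_simps)
  moreover have "w + cnj w \<noteq> 0" using w w by (rule half_plane_add_cnj_nonzero)
  ultimately have M\<zeta>0: "M \<zeta>0 = z" using zw by (simp add: M_def)
  have \<zeta>0: "norm \<zeta>0 < 1"
    using norm_diff_less_reflect[OF z w] zw by (simp add: \<zeta>0_def norm_divide)
  have ReM: "Re (M \<zeta>) > 0" if "norm \<zeta> < 1" for \<zeta>
  proof -
    have "1 - \<zeta> \<noteq> 0" using that by auto
    have "Re (M \<zeta>) = Re w * (1 - (norm \<zeta>)\<^sup>2) / (norm (1 - \<zeta>))\<^sup>2"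
      unfolding M_def Re_divide cmod_power2
      by (simp add: power2_eq_square algebra_simps add_divide_distrib diff_divide_distrib)
    moreover have "(norm \<zeta>)\<^sup>2 < 1" using that by (simp add: power_less_one_iff)
    ultimately show ?thesis using w \<open>1 - \<zeta> \<noteq> 0\<close> by simp
  qed
  have ne: "1 - \<zeta> \<noteq> 0" if "norm \<zeta> < 1" for \<zeta> :: complex using that by auto
  have "M holomorphic_on ball 0 1"
    unfolding M_def using ne by (intro holomorphic_intros) auto
  then have "(f \<circ> M) holomorphic_on ball 0 1"
    using hol ReM by (intro holomorphic_on_compose_gen[where t = "{z. Re z > 0}"]) auto
  then have holg: "g holomorphic_on ball 0 1"
    unfolding g_def using half_plane_add_cnj_nonzero[OF pos[OF ReM] pos[OF w]]
    by (intro holomorphic_intros) (auto simp: o_def)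
  have "norm (g \<zeta>0) \<le> norm \<zeta>0"
  proof (rule Schwarz_Lemma(1)[OF holg _ _ \<zeta>0])
    show "g 0 = 0" by (simp add: g_def M0)
    show "norm (g \<zeta>) < 1" if "norm \<zeta> < 1" for \<zeta>
      using norm_diff_less_reflect[OF pos[OF ReM[OF that]] pos[OF w]]
        half_plane_add_cnj_nonzero[OF pos[OF ReM[OF that]] pos[OF w]]
      by (simp add: g_def norm_divide)
  qed
  then have *: "norm ((f z - f w) / (f z + cnj (f w))) \<le> norm ((z - w) / (z + cnj w))"
    by (simp add: g_def M\<zeta>0 flip: \<zeta>0_def)
  have "norm (f z + cnj (f w)) > 0" "norm (z + cnj w) > 0"
    using half_plane_add_cnj_nonzero[OF pos[OF z] pos[OF w]] zw by simp_all
  with * show ?thesis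
    unfolding norm_divide by (simp add: field_simps)
qed

text \<open>
  Adding a small positive constant to \<open>f\<close> makes its real part strictly positive; let the constant
  tend to zero.
\<close>

lemma Schwarz_Pick_half_plane:
  assumes hol: "f holomorphic_on {z. Re z > 0}"
    and nn: "\<And>z. Re z > 0 \<Longrightarrow> Re (f z) \<ge> 0"
    and z: "Re z > 0" and w: "Re w > 0"
  shows "norm (f z - f w) * norm (z + cnj w) \<le> norm (z - w) * norm (f z + cnj (f w))"
proof -
  let ?R = "\<lambda>\<delta>. norm (z - w) * norm (f z + cnj (f w) + of_real (2 * \<delta>))"
  have "norm (f z - f w) * norm (z + cnj w) \<le> ?R \<delta>" if "\<delta> > 0" for \<delta> :: real
  proof -
    have "norm ((f z + \<delta>) - (f w + \<delta>)) * norm (z + cnj w)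
        \<le> norm (z - w) * norm ((f z + \<delta>) + cnj (f w + \<delta>))"
      using hol nn that z w
      by (intro Schwarz_Pick_half_plane_strict holomorphic_intros) (auto intro: add_nonneg_pos)
    then show ?thesis by (simp add: algebra_simps)
  qed
  moreover have "(?R \<longlongrightarrow> ?R 0) (at_right 0)"
    by (intro tendsto_intros)
  ultimately have "norm (f z - f w) * norm (z + cnj w) \<le> ?R 0"
    by (intro tendsto_lowerbound[where F = "at_right 0"])
       (auto simp: eventually_at_right_less intro!: eventually_at_rightI[of 0 1])
  then show ?thesis by simp
qed

text \<open>
  Squaring the Schwarz-Pick inequality and rewriting both differences by \<open>norm_reflect_diff\<close> makes the
  leading terms cancel. What remains is quadratic in \<open>Re (f z)\<close> on the left and linear on the right,
  so one factor can be divided out.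
\<close>

lemma Harnack_half_plane:
  assumes hol: "f holomorphic_on {z. Re z > 0}"
    and nn: "\<And>z. Re z > 0 \<Longrightarrow> Re (f z) \<ge> 0"
    and z: "Re z > 0" and w: "Re w > 0"
  shows "Re (f z) * (Re z * Re w) \<le> Re (f w) * (norm (z + cnj w))\<^sup>2"
proof (cases "Re (f z) = 0")
  case True
  then show ?thesis using nn[OF w] by simp
next
  case False
  let ?A = "Re (f z)" and ?B = "Re (f w)" and ?N = "(norm (f z + cnj (f w)))\<^sup>2"
    and ?n = "(norm (z + cnj w))\<^sup>2"
  have "(norm (f z - f w) * norm (z + cnj w))\<^sup>2 \<le> (norm (z - w) * norm (f z + cnj (f w)))\<^sup>2"
    by (intro power_mono Schwarz_Pick_half_plane[OF hol nn z w]) auto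
  then have "(norm (f z - f w))\<^sup>2 * ?n \<le> (norm (z - w))\<^sup>2 * ?N"
    by (simp add: power_mult_distrib)
  moreover have "(norm (f z - f w))\<^sup>2 = ?N - 4 * ?A * ?B" "(norm (z - w))\<^sup>2 = ?n - 4 * Re z * Re w"
    using norm_reflect_diff[of "f z" "f w"] norm_reflect_diff[of z w] by linarith+
  ultimately have 1: "Re z * Re w * ?N \<le> ?A * ?B * ?n"
    by (simp add: algebra_simps)
  have A: "?A > 0" using False nn[OF z] by simp
  have "?A \<le> Re (f z + cnj (f w))" using nn[OF w] by simp
  also have "\<dots> \<le> norm (f z + cnj (f w))" by (rule complex_Re_le_cmod)
  finally have "?A\<^sup>2 \<le> ?N" using A by (intro power_mono) auto
  then have "Re z * Re w * ?A\<^sup>2 \<le> Re z * Re w * ?N" using z w by (intro mult_left_mono) auto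
  with 1 have "?A * (?A * (Re z * Re w)) \<le> ?A * (?B * ?n)"
    by (simp add: power2_eq_square algebra_simps)
  then show ?thesis using A by simp
qed

text \<open>
  The infinitesimal form of Schwarz-Pick: divide by \<open>z - w\<close> and let \<open>z\<close> tend to \<open>w\<close>.
\<close>

lemma deriv_bound_half_plane:
  assumes hol: "f holomorphic_on {z. Re z > 0}"
    and nn: "\<And>z. Re z > 0 \<Longrightarrow> Re (f z) \<ge> 0"
    and w: "Re w > 0"
  shows "norm (deriv f w) * Re w \<le> Re (f w)"
proof -
  have op: "open {z. Re z > 0}" by (rule open_halfspace_Re_gt)
  have "(f has_field_derivative deriv f w) (at w)"
    using holomorphic_derivI[OF hol op] w by auto
  then have d: "((\<lambda>z. (f z - f w) / (z - w)) \<longlongrightarrow> deriv f w) (at w)"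
    by (simp add: has_field_derivative_iff)
  have c: "(f \<longlongrightarrow> f w) (at w)"
    using \<open>(f has_field_derivative _) _\<close> by (metis DERIV_isCont isCont_def)
  have "norm (deriv f w) * norm (w + cnj w) \<le> norm (f w + cnj (f w))"
  proof (rule tendsto_le[of "at w"])
    show "((\<lambda>z. norm ((f z - f w) / (z - w)) * norm (z + cnj w))
        \<longlongrightarrow> norm (deriv f w) * norm (w + cnj w)) (at w)"
      by (intro tendsto_intros d)
    show "((\<lambda>z. norm (f z + cnj (f w))) \<longlongrightarrow> norm (f w + cnj (f w))) (at w)"
      by (intro tendsto_intros c)
    have "\<forall>\<^sub>F z in at w. z \<in> {z. Re z > 0} - {w}"
      using w by (intro eventually_at_in_open op) auto
    then show "\<forall>\<^sub>F z in at w. norm ((f z - f w) / (z - w)) * norm (z + cnj w)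
        \<le> norm (f z + cnj (f w))"
    proof eventually_elim
      case (elim z)
      then show ?case
        using Schwarz_Pick_half_plane[OF hol nn _ w, of z] by (simp add: norm_divide field_simps)
    qed
  qed simp
  moreover have "norm (w + cnj w) = 2 * Re w" "norm (f w + cnj (f w)) = 2 * Re (f w)"
    using w nn[OF w] by (auto simp: complex_add_cnj norm_mult)
  ultimately show ?thesis by simp
qed

section \<open>Slices of the quaternions and the slice derivative\<close>

lemma imag_unit_square: "I \<in> imag_units \<Longrightarrow> I * I = - 1"
  by (simp add: imag_units_def power2_eq_square)

lemma imag_units_iff: "I \<in> imag_units \<longleftrightarrow> qRe I = 0 \<and> norm I = 1"
proof
  assume I: "I \<in> imag_units"
  then have sq: "I * I = - 1" by (rule imag_unit_square)
  then have "norm I * norm I = 1" by (metis norm_minus_cancel norm_mult norm_one)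
  then have n: "norm I = 1" by (metis norm_ge_zero square_eq_1_iff abs_of_nonneg abs_minus_cancel abs_one)
  have "qRe I * qI I = 0" "qRe I * qJ I = 0" "qRe I * qK I = 0"
    "qRe I * qRe I - qI I * qI I - qJ I * qJ I - qK I * qK I = - 1"
    using sq by (auto simp: quat_eq_iff)
  moreover have "qRe I * qRe I \<ge> 0" by simp
  ultimately have "qRe I = 0" by (cases "qRe I = 0") simp_all
  with n show "qRe I = 0 \<and> norm I = 1" by simp
next
  assume "qRe I = 0 \<and> norm I = 1"
  then show "I \<in> imag_units"
    by (auto simp: imag_units_def power2_eq_square quat_eq_iff norm_quat_def)
qed

lemma qRe_slice_point [simp]: "I \<in> imag_units \<Longrightarrow> qRe (slice_point I x y) = x"
  by (simp add: slice_point_def imag_units_iff)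

lemma norm_slice_point:
  assumes "I \<in> imag_units"
  shows "norm (slice_point I x y) = sqrt (x\<^sup>2 + y\<^sup>2)"
proof -
  have "qRe I = 0" "(qI I)\<^sup>2 + (qJ I)\<^sup>2 + (qK I)\<^sup>2 = 1"
    using assms by (auto simp: imag_units_iff norm_quat_def)
  moreover have "x\<^sup>2 + (y * qI I)\<^sup>2 + (y * qJ I)\<^sup>2 + (y * qK I)\<^sup>2
      = x\<^sup>2 + y\<^sup>2 * ((qI I)\<^sup>2 + (qJ I)\<^sup>2 + (qK I)\<^sup>2)"
    by (simp add: power_mult_distrib algebra_simps)
  ultimately show ?thesis
    by (simp add: slice_point_def norm_quat_def)
qed

abbreviation slice_emb :: "quat \<Rightarrow> complex \<Rightarrow> quat" where
  "slice_emb I z \<equiv> slice_point I (Re z) (Im z)"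

lemma norm_slice_emb: "I \<in> imag_units \<Longrightarrow> norm (slice_emb I z) = norm z"
  by (simp add: norm_slice_point cmod_def)

lemma slice_point_real [simp]: "slice_point I x 0 = of_real x"
  by (simp add: slice_point_def)

lemma slice_emb_of_real: "slice_emb I (of_real x) = of_real x"
  by simp

lemma slice_emb_diff: "slice_emb I (z - w) = slice_emb I z - slice_emb I w"
  by (simp add: slice_point_def algebra_simps)

lemma bounded_linear_slice_emb: "bounded_linear (slice_emb I)"
  unfolding slice_point_def
  by (intro bounded_linear_add bounded_linear_mult_const
      bounded_linear_compose[OF bounded_linear_of_real] bounded_linear_Re bounded_linear_Im)

lemma slice_emb_surj:
  obtains I z where "I \<in> imag_units" "q = slice_emb I z"
proof -
  define v where "v = q - of_real (qRe q)"
  define J where "J = (if v = 0 then Quat 0 1 0 0 else v /\<^sub>R norm v)"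
  have "J \<in> imag_units"
    by (auto simp: J_def imag_units_iff v_def norm_quat_def[of "Quat 0 1 0 0"])
  moreover have "q = slice_emb J (Complex (qRe q) (norm v))"
    by (auto simp: slice_point_def J_def v_def of_real_def)
  ultimately show ?thesis by (rule that)
qed

text \<open>
  Continuity of one partial derivative upgrades partial to total differentiability, and the
  Cauchy-Riemann equation \<open>\<partial>\<^sub>y f = I \<partial>\<^sub>x f\<close> turns the differential into left multiplication by points
  of the slice, applied to the single quaternion \<open>\<partial>\<^sub>x f\<close>. Using the complex plane as parameter space
  prepares the passage to holomorphic functions.
\<close>

lemma slice_regular_has_derivative:
  assumes reg: "slice_regular_on right_half_space f"
    and I: "I \<in> imag_units" and z: "Re z > 0"
  shows "((\<lambda>z. f (slice_emb I z)) has_derivative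
      (\<lambda>h. slice_emb I h * slice_dx f I (Re z) (Im z))) (at z)"
proof -
  let ?D = "slice_dx f I (Re z) (Im z)"
  let ?X = "{0<..} :: real set"
  have diff: "(\<lambda>t. f (slice_point I t y)) differentiable (at x)"
    "(\<lambda>t. f (slice_point I x t)) differentiable (at y)" 
    and CR: "slice_dx f I x y + I * slice_dy f I x y = 0" if "x > 0" for x y
    using reg I that by (auto simp: slice_regular_on_def right_half_space_def)
  have dom: "{(x, y). slice_point I x y \<in> right_half_space} = ?X \<times> UNIV"
    using I by (auto simp: right_half_space_def)
  have cont: "continuous_on (?X \<times> UNIV) (\<lambda>(x, y). slice_dy f I x y)"
    using reg I unfolding slice_regular_on_def by (metis dom)
  have dx: "((\<lambda>t. f (slice_point I t y)) has_derivative (\<lambda>h. h *\<^sub>R slice_dx f I x y)) (at x)"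
    if "x > 0" for x y
    using diff(1)[OF that, of y] unfolding slice_dx_def
    by (metis vector_derivative_works has_vector_derivative_def)
  have dy: "((\<lambda>t. f (slice_point I x t)) has_derivative
      blinfun_apply (blinfun_scaleR_left (slice_dy f I x y))) (at y)"
    if "x > 0" for x y
    using diff(2)[OF that, of y] unfolding slice_dy_def blinfun_scaleR_left.rep_eq
    by (metis vector_derivative_works has_vector_derivative_def)
  have c2: "continuous_on (?X \<times> UNIV) (\<lambda>p. blinfun_scaleR_left (slice_dy f I (fst p) (snd p)))"
    using cont by (intro bounded_linear.continuous_on[OF bounded_linear_blinfun_scaleR_left])
      (simp add: split_beta')
  have "((\<lambda>(x, y). f (slice_point I x y)) has_derivative
     (\<lambda>(tx, ty). tx *\<^sub>R ?D + blinfun_scaleR_left (slice_dy f I (Re z) (Im z)) ty))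
     (at (Re z, Im z) within ?X \<times> UNIV)"
    using z
    by (intro has_derivative_partialsI[where fy = "\<lambda>x y. blinfun_scaleR_left (slice_dy f I x y)"]
        has_derivative_at_withinI[OF dx] dy)
      (use c2 in \<open>auto simp: continuous_on_eq_continuous_within split_beta'\<close>)
  moreover have "at (Re z, Im z) within ?X \<times> UNIV = at (Re z, Im z)"
    using z by (intro at_within_open open_Times) auto
  ultimately have *: "((\<lambda>(x, y). f (slice_point I x y)) has_derivative
     (\<lambda>(tx, ty). tx *\<^sub>R ?D + ty *\<^sub>R slice_dy f I (Re z) (Im z))) (at (Re z, Im z))"
    by (simp add: blinfun_scaleR_left.rep_eq)
  have "((\<lambda>z. (Re z, Im z)) has_derivative (\<lambda>h. (Re h, Im h))) (at z)"
    by (intro derivative_intros bounded_linear_imp_has_derivative bounded_linear_Re bounded_linear_Im)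
  from has_derivative_compose[OF this *]
  have **: "((\<lambda>z. f (slice_emb I z)) has_derivative
      (\<lambda>h. Re h *\<^sub>R ?D + Im h *\<^sub>R slice_dy f I (Re z) (Im z))) (at z)"
    by simp
  have "I * (?D + I * slice_dy f I (Re z) (Im z)) = 0" using CR[OF z] by simp
  then have "slice_dy f I (Re z) (Im z) = I * ?D"
    using imag_unit_square[OF I] by (simp add: distrib_left mult.assoc[symmetric])
  then have "Re h *\<^sub>R ?D + Im h *\<^sub>R slice_dy f I (Re z) (Im z) = slice_emb I h * ?D" for h
    by (simp add: slice_point_def algebra_simps scaleR_conv_of_real)
  with ** show ?thesis by simp
qed

text \<open>
  The partial derivative in \<open>x\<close> is the derivative of \<open>f\<close> along a real translation of the point, so it
  depends on the point alone and not on the way it is written as \<open>x + y I\<close>. This is what makes the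
  slice derivative well defined, including at real points, which lie on all slices.
\<close>

lemma slice_dx_eq_translate:
  assumes "I \<in> imag_units"
  shows "slice_dx f I x y
    = vector_derivative (\<lambda>t. f (slice_point I x y + of_real (t - x))) (at x)"
  by (simp add: slice_dx_def slice_point_def algebra_simps)

lemma slice_deriv_eq_slice_dx:
  assumes reg: "slice_regular_on right_half_space f"
    and I: "I \<in> imag_units" and x: "x > 0"
  shows "slice_deriv f (slice_point I x y) = slice_dx f I x y"
proof -
  have half: "(1 / 2) *\<^sub>R (slice_dx f J x' y' - J * slice_dy f J x' y') = slice_dx f J x' y'"
    if "J \<in> imag_units" "x' > 0" for J x' y'
  proof -
    have "slice_dx f J x' y' + J * slice_dy f J x' y' = 0"
      using reg that by (auto simp: slice_regular_on_def right_half_space_def)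
    then have "J * slice_dy f J x' y' = - slice_dx f J x' y'"
      by (simp add: add_eq_0_iff)
    then show ?thesis by (simp add: scaleR_2[symmetric])
  qed
  have indep: "slice_dx f J x' y' = slice_dx f I x y"
    if "J \<in> imag_units" "slice_point I x y = slice_point J x' y'" for J x' y'
  proof -
    have "x' = x" using that I by (metis qRe_slice_point)
    then show ?thesis using that I by (simp add: slice_dx_eq_translate)
  qed
  show ?thesis
    unfolding slice_deriv_def
  proof (rule the_equality)
    show "\<forall>J\<in>imag_units. \<forall>x' y'. slice_point I x y = slice_point J x' y' \<longrightarrow>
        slice_dx f I x y = (1 / 2) *\<^sub>R (slice_dx f J x' y' - J * slice_dy f J x' y')"
    proof safe
      fix J x' y' assume J: "J \<in> imag_units" and e: "slice_point I x y = slice_point J x' y'"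
      have "x' > 0" using x J I e by (metis qRe_slice_point)
      then show "slice_dx f I x y = (1 / 2) *\<^sub>R (slice_dx f J x' y' - J * slice_dy f J x' y')"
        unfolding half[OF J \<open>x' > 0\<close>] using indep[OF J e] by simp
    qed
    show "d = slice_dx f I x y"
      if "\<forall>J\<in>imag_units. \<forall>x' y'. slice_point I x y = slice_point J x' y' \<longrightarrow>
        d = (1 / 2) *\<^sub>R (slice_dx f J x' y' - J * slice_dy f J x' y')" for d
      using that I half[OF I x] by auto
  qed
qed

section \<open>Holomorphic components and the passage between slices\<close>

text \<open>
  Left multiplication by \<open>I\<close> makes the quaternions a complex vector space. For a fixed \<open>p\<close> this is
  the complex-linear functional for that structure whose real part is the inner product with \<open>p\<close>.
\<close>

definition slice_cpart :: "quat \<Rightarrow> quat \<Rightarrow> quat \<Rightarrow> complex" where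
  "slice_cpart I p q = Complex (inner q p) (inner q (I * p))"

lemma slice_cpart_sel [simp]:
  "Re (slice_cpart I p q) = inner q p" "Im (slice_cpart I p q) = inner q (I * p)"
  by (simp_all add: slice_cpart_def)

lemma bounded_linear_slice_cpart: "bounded_linear (slice_cpart I p)"
  unfolding slice_cpart_def Complex_eq
  by (intro bounded_linear_add bounded_linear_const_mult
      bounded_linear_compose[OF bounded_linear_of_real] bounded_linear_inner_left)

lemma inner_imag_unit_mult:
  assumes "I \<in> imag_units"
  shows "inner (I * q) p = - inner q (I * p)"
  using assms by (simp add: imag_units_iff inner_quat_def algebra_simps)

lemma slice_cpart_slice_emb_mult:
  assumes I: "I \<in> imag_units"
  shows "slice_cpart I p (slice_emb I z * q) = z * slice_cpart I p q"
proof -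
  have "inner (I * q) (I * p) = inner q p"
    using inner_imag_unit_mult[OF I, of q "I * p"] imag_unit_square[OF I]
    by (simp add: mult.assoc[symmetric])
  moreover have "slice_emb I z * q = Re z *\<^sub>R q + Im z *\<^sub>R (I * q)"
    by (simp add: slice_point_def scaleR_conv_of_real distrib_right mult.assoc)
  ultimately show ?thesis
    by (simp add: complex_eq_iff inner_add_left inner_imag_unit_mult[OF I])
qed

definition slice_component :: "(quat \<Rightarrow> quat) \<Rightarrow> quat \<Rightarrow> quat \<Rightarrow> complex \<Rightarrow> complex" where
  "slice_component f I p z = slice_cpart I p (f (slice_emb I z))"

text \<open>
  Complex linearity of the functional turns the differential of \<open>f\<close> on the slice, which is left
  multiplication by slice points, into multiplication by a complex number. Hence every component is
  holomorphic.
\<close>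

lemma slice_component_has_field_derivative:
  assumes reg: "slice_regular_on right_half_space f"
    and I: "I \<in> imag_units" and z: "Re z > 0"
  shows "(slice_component f I p has_field_derivative
      slice_cpart I p (slice_dx f I (Re z) (Im z))) (at z)"
proof -
  have "((\<lambda>w. slice_cpart I p (f (slice_emb I w))) has_derivative
      (\<lambda>h. slice_cpart I p (slice_emb I h * slice_dx f I (Re z) (Im z)))) (at z)"
    by (intro bounded_linear.has_derivative[OF bounded_linear_slice_cpart]
        slice_regular_has_derivative[OF reg I z])
  then show ?thesis
    unfolding slice_component_def[abs_def]
    by (rule has_derivative_imp_has_field_derivative) (simp add: slice_cpart_slice_emb_mult[OF I])
qed

lemma slice_component_holomorphic:
  assumes "slice_regular_on right_half_space f" "I \<in> imag_units"
  shows "slice_component f I p holomorphic_on {z. Re z > 0}"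
  using slice_component_has_field_derivative[OF assms]
  by (auto simp: holomorphic_on_open[OF open_halfspace_Re_gt])

text \<open>
  Identity theorem for the right half-plane, with the positive real axis as the set of coincidence.
\<close>

lemma deriv_eq_if_eq_on_positive_reals:
  assumes F: "F holomorphic_on {z. Re z > 0}" and G: "G holomorphic_on {z. Re z > 0}"
    and eq: "\<And>x. x > 0 \<Longrightarrow> F (of_real x) = G (of_real x)"
    and z: "Re z > 0"
  shows "deriv F z = deriv G z"
proof -
  let ?S = "{z. Re z > 0}"
  have op: "open ?S" by (rule open_halfspace_Re_gt)
  have lim: "(1::complex) islimpt (of_real ` {0<..})"
    unfolding islimpt_approachable
  proof safe
    fix e :: real assume "e > 0"
    then show "\<exists>x'\<in>of_real ` {0<..}. x' \<noteq> (1::complex) \<and> dist x' 1 < e"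
      by (intro bexI[of _ "of_real (1 + e / 2)"] imageI) (auto simp: dist_norm)
  qed
  have "F w - G w = 0" if "w \<in> ?S" for w
  proof (rule analytic_continuation[of "\<lambda>w. F w - G w" ?S "of_real ` {0<..}" 1])
    show "connected ?S" by (intro convex_connected convex_halfspace_Re_gt)
  qed (use F G eq op lim that in \<open>auto intro!: holomorphic_intros\<close>)
  then show ?thesis
    using z by (intro complex_derivative_transform_within_open[OF F G op]) auto
qed

text \<open>
  On the real axis \<open>even_stem g\<close> and \<open>odd_stem g\<close> are the real and the imaginary part of \<open>g\<close>; both are
  holomorphic when \<open>g\<close> is, so they are the holomorphic extensions of these two real functions.
\<close>

definition even_stem :: "(complex \<Rightarrow> complex) \<Rightarrow> complex \<Rightarrow> complex" where
  "even_stem g z = (g z + cnj (g (cnj z))) / 2"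

definition odd_stem :: "(complex \<Rightarrow> complex) \<Rightarrow> complex \<Rightarrow> complex" where
  "odd_stem g z = (g z - cnj (g (cnj z))) / (2 * \<i>)"

lemma stem_of_real:
  "even_stem g (of_real x) = of_real (Re (g (of_real x)))"
  "odd_stem g (of_real x) = of_real (Im (g (of_real x)))"
  by (simp_all add: even_stem_def odd_stem_def complex_eq_iff)

lemma stem_has_field_derivative:
  assumes "(g has_field_derivative d) (at z)" "(g has_field_derivative e) (at (cnj z))"
  shows "(even_stem g has_field_derivative (d + cnj e) / 2) (at z)"
    "(odd_stem g has_field_derivative (d - cnj e) / (2 * \<i>)) (at z)"
proof -
  have "((\<lambda>z. cnj (g (cnj z))) has_field_derivative cnj e) (at z)"
    using has_field_derivative_cnj_cnj[OF assms(2)] by (simp add: o_def)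
  with assms(1) show "(even_stem g has_field_derivative (d + cnj e) / 2) (at z)"
    "(odd_stem g has_field_derivative (d - cnj e) / (2 * \<i>)) (at z)"
    unfolding even_stem_def[abs_def] odd_stem_def[abs_def]
    by (auto intro!: derivative_eq_intros)
qed

lemma stem_holomorphic:
  assumes "g holomorphic_on {z. Re z > 0}"
  shows "even_stem g holomorphic_on {z. Re z > 0}" "odd_stem g holomorphic_on {z. Re z > 0}"
proof -
  have "(g has_field_derivative deriv g w) (at w)" if "Re w > 0" for w
    using holomorphic_derivI[OF assms open_halfspace_Re_gt] that by auto
  then show "even_stem g holomorphic_on {z. Re z > 0}" "odd_stem g holomorphic_on {z. Re z > 0}"
    unfolding holomorphic_on_open[OF open_halfspace_Re_gt]
    using stem_has_field_derivative by (auto, metis complex_cnj_cnj cnj.sel(1), metis complex_cnj_cnj cnj.sel(1))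
qed

abbreviation (input) "unit_i \<equiv> Quat 0 1 0 0"
abbreviation (input) "unit_j \<equiv> Quat 0 0 1 0"
abbreviation (input) "unit_k \<equiv> Quat 0 0 0 1"

lemma basis_imag_units: "unit_i \<in> imag_units" "unit_j \<in> imag_units" "unit_k \<in> imag_units"
  by (simp_all add: imag_units_iff norm_quat_def)

text \<open>
  The bridge between different slices. The component \<open>slice_component f I 1\<close> restricts on the real axis
  to \<open>Re f + \<i> \<langle>f, I\<rangle>\<close>. Taking \<open>I\<close> to be each of the three standard units, its even and odd stems
  extend all four real components of \<open>f\<close> holomorphically from the real axis. On any slice \<open>I\<close>, both \<open>f\<close> and the sum
  of the four extensions times the standard basis have holomorphic components that agree on the real
  axis, and so they coincide. In this way the derivative of \<open>f\<close>, with all its components, is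
  expressed by components whose real part is the real part of \<open>f\<close>, the only quantity about which
  positivity gives information.
\<close>

lemma slice_dx_stem_expansion:
  assumes reg: "slice_regular_on right_half_space f"
    and I: "I \<in> imag_units" and z: "Re z > 0"
  shows "slice_dx f I (Re z) (Im z) =
      slice_emb I (deriv (even_stem (slice_component f unit_i 1)) z)
    + slice_emb I (deriv (odd_stem (slice_component f unit_i 1)) z) * unit_i
    + slice_emb I (deriv (odd_stem (slice_component f unit_j 1)) z) * unit_j
    + slice_emb I (deriv (odd_stem (slice_component f unit_k 1)) z) * unit_k"
    (is "?lhs = slice_emb I (deriv ?h0 z) + slice_emb I (deriv ?h1 z) * unit_i
      + slice_emb I (deriv ?h2 z) * unit_j + slice_emb I (deriv ?h3 z) * unit_k" is "_ = ?rhs")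
proof -
  have op: "open {z. Re z > 0}" by (rule open_halfspace_Re_gt)
  note hol = stem_holomorphic[OF slice_component_holomorphic[OF reg]]
  have h: "?h0 holomorphic_on {z. Re z > 0}" "?h1 holomorphic_on {z. Re z > 0}"
    "?h2 holomorphic_on {z. Re z > 0}" "?h3 holomorphic_on {z. Re z > 0}"
    by (intro hol basis_imag_units)+
  have d: "(?h0 has_field_derivative deriv ?h0 z) (at z)"
    "(?h1 has_field_derivative deriv ?h1 z) (at z)"
    "(?h2 has_field_derivative deriv ?h2 z) (at z)"
    "(?h3 has_field_derivative deriv ?h3 z) (at z)"
    using z by (auto intro!: holomorphic_derivI[OF _ op] h)
  have lin: "linear (slice_cpart I p)" for p
    by (rule bounded_linear.linear[OF bounded_linear_slice_cpart])
  \<comment> \<open>The functionals for varying \<open>p\<close> separate quaternions, so it suffices to compare components.\<close>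
  have "slice_cpart I p ?lhs = slice_cpart I p ?rhs" for p
  proof -
    let ?G = "\<lambda>z. ?h0 z * slice_cpart I p 1 + ?h1 z * slice_cpart I p unit_i
      + ?h2 z * slice_cpart I p unit_j + ?h3 z * slice_cpart I p unit_k"
    have "slice_cpart I p ?lhs = deriv (slice_component f I p) z"
      using slice_component_has_field_derivative[OF reg I z] by (metis DERIV_imp_deriv)
    also have "\<dots> = deriv ?G z"
    proof (rule deriv_eq_if_eq_on_positive_reals[OF _ _ _ z])
      show "slice_component f I p holomorphic_on {z. Re z > 0}"
        by (rule slice_component_holomorphic[OF reg I])
      show "?G holomorphic_on {z. Re z > 0}" by (intro holomorphic_intros h)
      show "slice_component f I p (of_real x) = ?G (of_real x)" for x
        unfolding stem_of_real slice_component_def slice_emb_of_real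
        by (simp add: complex_eq_iff inner_quat_def)
    qed
    also have "\<dots> = deriv ?h0 z * slice_cpart I p 1 + deriv ?h1 z * slice_cpart I p unit_i
      + deriv ?h2 z * slice_cpart I p unit_j + deriv ?h3 z * slice_cpart I p unit_k"
      by (rule DERIV_imp_deriv) (auto intro!: derivative_eq_intros d)
    also have "\<dots> = slice_cpart I p (slice_emb I (deriv ?h0 z) * 1
      + slice_emb I (deriv ?h1 z) * unit_i
      + slice_emb I (deriv ?h2 z) * unit_j + slice_emb I (deriv ?h3 z) * unit_k)"
      by (simp only: linear_add[OF lin] slice_cpart_slice_emb_mult[OF I])
    finally show ?thesis by simp
  qed
  then have "inner ?lhs p = inner ?rhs p" for p
    by (metis slice_cpart_sel(1))
  then show ?thesis by (metis vector_eq_rdot)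
qed

lemma norm_stem_bounds:
  fixes a b :: complex
  assumes "norm a \<le> B" "norm b \<le> B"
  shows "norm ((a + cnj b) / 2) \<le> B" "norm ((a - cnj b) / (2 * \<i>)) \<le> B"
  using assms norm_triangle_ineq[of a "cnj b"] norm_triangle_ineq4[of a "cnj b"]
  by (simp_all add: norm_divide norm_mult)

text \<open>
  Passing to a stem averages the values at \<open>z\<close> and \<open>cnj z\<close>. A real constant \<open>c\<close> survives in the even
  stem and cancels in the odd ones, so all four coefficients of \<open>f' - c\<close> inherit the bound.
\<close>

lemma slice_dx_diff_real_bound:
  assumes reg: "slice_regular_on right_half_space f"
    and I: "I \<in> imag_units" and z: "Re z > 0"
    and bound: "\<And>J w. J \<in> imag_units \<Longrightarrow> w \<in> {z, cnj z} \<Longrightarrow>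
      norm (deriv (slice_component f J 1) w - of_real c) \<le> B"
  shows "norm (slice_dx f I (Re z) (Im z) - of_real c) \<le> 4 * B"
proof -
  have d: "(slice_component f J 1 has_field_derivative deriv (slice_component f J 1) w) (at w)"
    if "J \<in> imag_units" "w \<in> {z, cnj z}" for J w
    using z that slice_component_holomorphic[OF reg, of J]
    by (intro holomorphic_derivI[OF _ open_halfspace_Re_gt]) auto
  have even: "norm (deriv (even_stem (slice_component f J 1)) z - of_real c) \<le> B"
    and odd: "norm (deriv (odd_stem (slice_component f J 1)) z) \<le> B"
    if J: "J \<in> imag_units" for J
  proof -
    let ?a = "deriv (slice_component f J 1) z - of_real c"
      and ?b = "deriv (slice_component f J 1) (cnj z) - of_real c"
    have ab: "norm ?a \<le> B" "norm ?b \<le> B"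
      by (rule bound[OF J]; simp)+
    note ds = stem_has_field_derivative[OF d[OF J] d[OF J], THEN DERIV_imp_deriv, of z]
    have "deriv (even_stem (slice_component f J 1)) z - of_real c = (?a + cnj ?b) / 2"
      by (simp add: ds field_simps)
    then show "norm (deriv (even_stem (slice_component f J 1)) z - of_real c) \<le> B"
      using norm_stem_bounds(1)[OF ab] by metis
    have "deriv (odd_stem (slice_component f J 1)) z = (?a - cnj ?b) / (2 * \<i>)"
      by (simp add: ds)
    then show "norm (deriv (odd_stem (slice_component f J 1)) z) \<le> B"
      using norm_stem_bounds(2)[OF ab] by metis
  qed
  let ?h0 = "deriv (even_stem (slice_component f unit_i 1)) z"
    and ?h1 = "deriv (odd_stem (slice_component f unit_i 1)) z"
    and ?h2 = "deriv (odd_stem (slice_component f unit_j 1)) z"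
    and ?h3 = "deriv (odd_stem (slice_component f unit_k 1)) z"
  have h0: "slice_emb I (?h0 - of_real c) = slice_emb I ?h0 - of_real c"
    using slice_emb_diff[of I ?h0 "of_real c"] unfolding slice_emb_of_real .
  have "slice_dx f I (Re z) (Im z) - of_real c = slice_emb I (?h0 - of_real c)
      + slice_emb I ?h1 * unit_i + slice_emb I ?h2 * unit_j + slice_emb I ?h3 * unit_k"
    unfolding slice_dx_stem_expansion[OF reg I z] h0 by simp
  moreover have "norm (a + b * unit_i + d * unit_j + e * unit_k)
      \<le> norm a + norm b + norm d + norm e" for a b d e
    using norm_triangle_ineq[of "a + b * unit_i + d * unit_j" "e * unit_k"]
      norm_triangle_ineq[of "a + b * unit_i" "d * unit_j"] norm_triangle_ineq[of a "b * unit_i"]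
      basis_imag_units by (simp add: norm_mult imag_units_iff)
  ultimately have "norm (slice_dx f I (Re z) (Im z) - of_real c)
      \<le> norm (?h0 - of_real c) + norm ?h1 + norm ?h2 + norm ?h3"
    unfolding norm_slice_emb[OF I, symmetric] by metis
  also have "\<dots> \<le> B + B + B + B"
    by (intro add_mono even odd basis_imag_units)
  finally show ?thesis by simp
qed

section \<open>Estimates in sectors\<close>

lemma Re_slice_component_1: "Re (slice_component f I 1 z) = qRe (f (slice_emb I z))"
  by (simp add: slice_component_def inner_quat_def)

text \<open>
  The function \<open>\<psi>\<close> is the component of \<open>f(q) - q c\<close> on one slice: holomorphic with nonnegative real
  part, which is the form that the half-plane estimates need.
\<close>

lemma excess_component:
  assumes reg: "slice_regular_on right_half_space f"
    and lower: "\<forall>q\<in>right_half_space. c * qRe q \<le> qRe (f q)"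
    and I: "I \<in> imag_units"
    and \<psi>_def: "\<psi> = (\<lambda>z. slice_component f I 1 z - of_real c * z)"
  shows "\<psi> holomorphic_on {z. Re z > 0}"
    and "Re z > 0 \<Longrightarrow> Re (\<psi> z) \<ge> 0"
    and "Re (\<psi> z) = qRe (f (slice_emb I z)) - c * Re z"
    and "Re z > 0 \<Longrightarrow> deriv \<psi> z = deriv (slice_component f I 1) z - of_real c"
proof -
  note hol = slice_component_holomorphic[OF reg I, of 1]
  show "\<psi> holomorphic_on {z. Re z > 0}"
    unfolding \<psi>_def by (intro holomorphic_intros hol)
  show R: "Re (\<psi> z) = qRe (f (slice_emb I z)) - c * Re z" for z
    by (simp add: \<psi>_def Re_slice_component_1)
  show "Re (\<psi> z) \<ge> 0" if "Re z > 0"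
    unfolding R using bspec[OF lower, of "slice_emb I z"] that I
    by (simp add: right_half_space_def)
  show "deriv \<psi> z = deriv (slice_component f I 1) z - of_real c" if "Re z > 0"
    unfolding \<psi>_def
    using holomorphic_derivI[OF hol open_halfspace_Re_gt, of z] that
    by (intro DERIV_imp_deriv) (auto intro!: derivative_eq_intros)
qed

text \<open>
  Choose \<open>q\<close> that nearly attains the infimum. Harnack's inequality on the slice through \<open>q\<close>
  transports its small excess to the positive real axis, which is common to all slices; this is the
  reason why the infima over the single slices all agree.
\<close>

lemma excess_ratio_on_axis_tendsto_0:
  assumes reg: "slice_regular_on right_half_space f"
    and lower: "\<forall>q\<in>right_half_space. c * qRe q \<le> qRe (f q)"
    and almost: "\<And>e. e > 0 \<Longrightarrow> \<exists>q. qRe q > 0 \<and> qRe (f q) < (c + e) * qRe q"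
  shows "((\<lambda>x. (qRe (f (of_real x)) - c * x) / x) \<longlongrightarrow> 0) at_top"
proof (rule tendstoI)
  fix e :: real assume "e > 0"
  then obtain q where q: "qRe q > 0" "qRe (f q) < (c + e / 4) * qRe q"
    using almost[of "e / 4"] by auto
  obtain I w where I: "I \<in> imag_units" and qw: "q = slice_emb I w" by (rule slice_emb_surj)
  have w: "Re w > 0" using q I qw by simp
  define \<psi> where "\<psi> = (\<lambda>z. slice_component f I 1 z - of_real c * z)"
  note \<psi> = excess_component[OF reg lower I \<psi>_def]
  have small: "Re (\<psi> w) < e / 4 * Re w"
    using q I by (simp add: \<psi>(3) qw algebra_simps)
  \<comment> \<open>The choice \<open>e / 4\<close> compensates \<open>norm (x + cnj w) \<le> 2 x\<close>, squared.\<close>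
  have "dist ((qRe (f (of_real x)) - c * x) / x) 0 < e" if x: "x > norm w" "x > 0" for x
  proof -
    let ?u = "qRe (f (of_real x)) - c * x"
    have u: "Re (\<psi> (of_real x)) = ?u" by (simp add: \<psi>(3))
    have "norm (of_real x + cnj w) \<le> 2 * x"
      using norm_triangle_ineq[of "of_real x" "cnj w"] x by simp
    then have "(norm (of_real x + cnj w))\<^sup>2 \<le> (2 * x)\<^sup>2" by (intro power_mono) auto
    then have n: "(norm (of_real x + cnj w))\<^sup>2 \<le> 4 * x\<^sup>2" by (simp add: power_mult_distrib)
    have "?u * (x * Re w) \<le> Re (\<psi> w) * (norm (of_real x + cnj w))\<^sup>2"
      using Harnack_half_plane[OF \<psi>(1,2), of "of_real x" w] x w u by simp
    also have "\<dots> \<le> Re (\<psi> w) * (4 * x\<^sup>2)"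
      using \<psi>(2)[OF w] n by (intro mult_left_mono) auto
    also have "\<dots> < (e / 4 * Re w) * (4 * x\<^sup>2)"
      using small x by (intro mult_strict_right_mono) auto
    finally have "?u * (x * Re w) < (e * x) * (x * Re w)"
      by (simp add: power2_eq_square algebra_simps)
    then have "?u < e * x" using x w by (simp add: mult_less_cancel_right)
    moreover have "?u \<ge> 0" using \<psi>(2)[of "of_real x"] x u by simp
    ultimately show ?thesis using x by (simp add: dist_norm field_simps)
  qed
  then show "\<forall>\<^sub>F x in at_top. dist ((qRe (f (of_real x)) - c * x) / x) 0 < e"
    by (intro eventually_mono[OF eventually_conj[OF eventually_gt_at_top[of "norm w"] eventually_gt_at_top[of 0]]])
      auto
qed

text \<open>
  Harnack's inequality between \<open>z\<close> and its projection \<open>Re z\<close> to the real axis costs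
  \<open>(norm (z + Re z) / Re z)\<^sup>2\<close>, which in the sector is at most \<open>(1 + 1 / \<gamma>)\<^sup>2\<close>. The bound on the right is taken on
  the real axis and is therefore the same for every slice.
\<close>

lemma deriv_slice_component_bound:
  assumes reg: "slice_regular_on right_half_space f"
    and lower: "\<forall>q\<in>right_half_space. c * qRe q \<le> qRe (f q)"
    and I: "I \<in> imag_units" and \<gamma>: "\<gamma> > 0" and z: "Re z > 0" "Re z > \<gamma> * norm z"
  shows "norm (deriv (slice_component f I 1) z - of_real c)
    \<le> (1 + 1 / \<gamma>)\<^sup>2 * ((qRe (f (of_real (Re z))) - c * Re z) / Re z)"
proof -
  define \<psi> where "\<psi> = (\<lambda>z. slice_component f I 1 z - of_real c * z)"
  note \<psi> = excess_component[OF reg lower I \<psi>_def]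
  let ?x = "Re z" let ?u = "qRe (f (of_real ?x)) - c * ?x"
  have u: "Re (\<psi> (of_real ?x)) = ?u" by (simp add: \<psi>(3))
  have u0: "?u \<ge> 0" using \<psi>(2)[of "of_real ?x"] z u by simp
  have "norm (z + of_real ?x) \<le> norm z + ?x"
    using norm_triangle_ineq[of z "of_real ?x"] z by simp
  also have "norm z \<le> ?x / \<gamma>" using z \<gamma> by (simp add: field_simps)
  finally have "norm (z + of_real ?x) \<le> (1 + 1 / \<gamma>) * ?x" by (simp add: algebra_simps)
  then have "(norm (z + of_real ?x))\<^sup>2 \<le> ((1 + 1 / \<gamma>) * ?x)\<^sup>2" by (intro power_mono) auto
  then have "?u * (norm (z + of_real ?x))\<^sup>2 \<le> ?u * ((1 + 1 / \<gamma>) * ?x)\<^sup>2"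
    using u0 by (intro mult_left_mono)
  moreover have "Re (\<psi> z) * (?x * ?x) \<le> ?u * (norm (z + of_real ?x))\<^sup>2"
    using Harnack_half_plane[OF \<psi>(1,2), of z "of_real ?x"] z u by simp
  ultimately have "Re (\<psi> z) * (?x * ?x) \<le> ((1 + 1 / \<gamma>)\<^sup>2 * ?u) * (?x * ?x)"
    unfolding power_mult_distrib by (simp add: power2_eq_square mult_ac)
  then have "Re (\<psi> z) \<le> (1 + 1 / \<gamma>)\<^sup>2 * ?u" using z by simp
  with deriv_bound_half_plane[OF \<psi>(1,2) z(1)]
  have "norm (deriv \<psi> z) * ?x \<le> (1 + 1 / \<gamma>)\<^sup>2 * ?u" by simp
  then show ?thesis using z by (simp add: \<psi>(4) field_simps)
qed

lemma slice_dx_bound: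
  assumes reg: "slice_regular_on right_half_space f"
    and lower: "\<forall>q\<in>right_half_space. c * qRe q \<le> qRe (f q)"
    and I: "I \<in> imag_units" and \<gamma>: "\<gamma> > 0" and z: "Re z > 0" "Re z > \<gamma> * norm z"
  shows "norm (slice_dx f I (Re z) (Im z) - of_real c)
    \<le> 4 * ((1 + 1 / \<gamma>)\<^sup>2 * ((qRe (f (of_real (Re z))) - c * Re z) / Re z))"
proof (rule slice_dx_diff_real_bound[OF reg I z(1)])
  fix J w assume J: "J \<in> imag_units" and w: "w \<in> {z, cnj z}"
  then have "Re w = Re z" "norm w = norm z" by auto
  then show "norm (deriv (slice_component f J 1) w - of_real c)
      \<le> (1 + 1 / \<gamma>)\<^sup>2 * ((qRe (f (of_real (Re z))) - c * Re z) / Re z)"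
    using deriv_slice_component_bound[OF reg lower J \<gamma>, of w] z by simp
qed

text \<open>
  The sector is cut off by a vertical line and not by a circle, since only then is the remaining
  region convex, as the mean value inequality requires.
\<close>

lemma convex_truncated_sector:
  assumes "\<gamma> \<ge> 0"
  shows "convex {z. R \<le> Re z \<and> \<gamma> * norm z < Re z}"
proof -
  have "convex {z. \<gamma> * norm z < Re z}"
  proof (rule convexI, clarify)
    fix z w :: complex and s t :: real
    assume *: "\<gamma> * norm z < Re z" "\<gamma> * norm w < Re w" "s \<ge> 0" "t \<ge> 0" "s + t = 1"
    have "\<gamma> * norm (s *\<^sub>R z + t *\<^sub>R w) \<le> \<gamma> * (s * norm z + t * norm w)"
      using * assms norm_triangle_ineq[of "s *\<^sub>R z" "t *\<^sub>R w"] by (intro mult_left_mono) auto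
    also have "\<dots> = s * (\<gamma> * norm z) + t * (\<gamma> * norm w)" by (simp add: algebra_simps)
    also have "\<dots> < s * Re z + t * Re w"
    proof (cases "s = 0")
      case True
      then show ?thesis using * by simp
    next
      case False
      then show ?thesis using * by (intro add_less_le_mono mult_strict_left_mono mult_left_mono) auto
    qed
    finally show "\<gamma> * norm (s *\<^sub>R z + t *\<^sub>R w) < Re (s *\<^sub>R z + t *\<^sub>R w)" by simp
  qed
  then have "convex ({z. Re z \<ge> R} \<inter> {z. \<gamma> * norm z < Re z})"
    by (intro convex_Int convex_halfspace_Re_ge)
  then show ?thesis by (simp add: Int_def)
qed

lemma mult_of_real_quat: "q * of_real c = c *\<^sub>R (q :: quat)"
  by (simp add: quat_eq_iff mult.commute)

text \<open>
  Integrate the bound on \<open>f' - c\<close> from the real point \<open>R\<close>, which lies on every slice; the constant of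
  integration is thus independent of \<open>I\<close>.
\<close>

lemma growth_from_slice_dx_bound:
  assumes reg: "slice_regular_on right_half_space f"
    and I: "I \<in> imag_units" and \<gamma>: "0 < \<gamma>" "\<gamma> < 1" and R: "R > 0"
    and dx: "\<And>z. R \<le> Re z \<Longrightarrow> \<gamma> * norm z < Re z \<Longrightarrow>
      norm (slice_dx f I (Re z) (Im z) - of_real c) \<le> e"
    and z: "R \<le> Re z" "\<gamma> * norm z < Re z"
  shows "norm (f (slice_emb I z) - c *\<^sub>R slice_emb I z)
    \<le> e * (norm z + R) + norm (f (of_real R) - of_real (c * R))"
proof -
  let ?S = "{z. R \<le> Re z \<and> \<gamma> * norm z < Re z}"
  let ?g = "\<lambda>z. f (slice_emb I z) - c *\<^sub>R slice_emb I z"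
  have e: "e \<ge> 0" by (rule order_trans[OF norm_ge_zero dx[OF z]])
  have "norm (?g z - ?g (of_real R)) \<le> e * norm (z - of_real R)"
  proof (rule differentiable_bound[of ?S ?g
      "\<lambda>z h. slice_emb I h * (slice_dx f I (Re z) (Im z) - of_real c)"])
    show "convex ?S" using \<gamma> by (intro convex_truncated_sector) auto
    show "(?g has_derivative (\<lambda>h. slice_emb I h * (slice_dx f I (Re w) (Im w) - of_real c)))
        (at w within ?S)" if "w \<in> ?S" for w
    proof (rule has_derivative_at_withinI)
      have "Re w > 0" using that R by auto
      from has_derivative_diff[OF slice_regular_has_derivative[OF reg I this]
          has_derivative_scaleR_right[OF bounded_linear_imp_has_derivative[OF bounded_linear_slice_emb]]]
      show "(?g has_derivative (\<lambda>h. slice_emb I h * (slice_dx f I (Re w) (Im w) - of_real c))) (at w)"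
        by (simp only: right_diff_distrib mult_of_real_quat)
    qed
    show "onorm (\<lambda>h. slice_emb I h * (slice_dx f I (Re w) (Im w) - of_real c)) \<le> e"
      if "w \<in> ?S" for w
    proof (rule onorm_bound[OF e])
      show "norm (slice_emb I h * (slice_dx f I (Re w) (Im w) - of_real c)) \<le> e * norm h" for h
        unfolding norm_mult norm_slice_emb[OF I]
        using mult_left_mono[OF dx[of w], of "norm h"] that by (simp add: mult.commute)
    qed
    show "z \<in> ?S" using z by simp
    show "of_real R \<in> ?S" using R \<gamma> by simp
  qed
  also have "\<dots> \<le> e * (norm z + R)"
    using e R norm_triangle_ineq4[of z "of_real R"] by (intro mult_left_mono) auto
  finally have "norm (?g z) \<le> e * (norm z + R) + norm (?g (of_real R))"
    using norm_triangle_sub[of "?g z" "?g (of_real R)"] by linarith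
  moreover have "?g (of_real R) = f (of_real R) - of_real (c * R)"
    by (simp add: mult_of_real_quat[symmetric] mult.commute)
  ultimately show ?thesis by simp
qed

text \<open>
  In the sector \<open>qRe q > \<gamma> * norm q\<close>, so the real part tends to infinity together with the norm.
\<close>

lemma eventually_sector_at_infinity:
  assumes "eventually P at_top" "\<gamma> > 0"
  shows "\<forall>\<^sub>F q in sector_at_infinity \<gamma>. q \<in> sector \<gamma> \<and> P (qRe q) \<and> P (norm q)"
proof -
  obtain N where N: "\<And>x. x \<ge> N \<Longrightarrow> P x" using assms(1) by (auto simp: eventually_at_top_linorder)
  have "\<forall>\<^sub>F q :: quat in at_infinity. norm q \<ge> max N (N / \<gamma>)"
    unfolding eventually_at_infinity by blast
  then show ?thesis
    unfolding sector_at_infinity_def eventually_inf_principal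
  proof (eventually_elim, safe)
    fix q :: quat assume n: "norm q \<ge> max N (N / \<gamma>)" and q: "q \<in> sector \<gamma>"
    from n show "P (norm q)" by (intro N) simp
    have "N \<le> \<gamma> * norm q" using n assms(2) by (simp add: field_simps)
    with q show "P (qRe q)" by (intro N) (auto simp: sector_def)
  qed
qed

section \<open>Asymptotics at infinity\<close>

theorem theorem9:
  fixes f :: "quat \<Rightarrow> quat" and c :: real
  assumes "slice_regular_on right_half_space f"
    and "f ` right_half_space \<subseteq> right_half_space"
    and "c = (INF q\<in>right_half_space. qRe (f q) / qRe q)"
  shows "c \<ge> 0 \<and>
    (\<forall>q\<in>right_half_space. qRe (f q) \<ge> c * qRe q) \<and>
    (\<forall>\<gamma>\<in>{0<..<1}.
      ((\<lambda>q. inverse q * f q) \<longlongrightarrow> of_real c) (sector_at_infinity \<gamma>) \<and>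
      ((\<lambda>q. qRe (f q) / qRe q) \<longlongrightarrow> c) (sector_at_infinity \<gamma>)) \<and>
    (\<forall>\<gamma>\<in>{0<..<1}. (slice_deriv f \<longlongrightarrow> of_real c) (sector_at_infinity \<gamma>))"
proof -
  note reg = assms(1)
  let ?H = right_half_space
  have ne: "?H \<noteq> {}" by (auto simp: right_half_space_def intro!: exI[of _ 1])
  have quot_nonneg: "0 \<le> qRe (f q) / qRe q" if "q \<in> ?H" for q
    using assms(2) that by (force simp: right_half_space_def)
  then have bdd: "bdd_below ((\<lambda>q. qRe (f q) / qRe q) ` ?H)" by (intro bdd_belowI2)
  have c0: "c \<ge> 0" unfolding assms(3) using ne quot_nonneg by (intro cINF_greatest)
  have lower: "\<forall>q\<in>?H. c * qRe q \<le> qRe (f q)"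
    using cINF_lower[OF bdd, folded assms(3)] by (auto simp: right_half_space_def field_simps)
  have almost: "\<exists>q. qRe q > 0 \<and> qRe (f q) < (c + e) * qRe q" if "e > 0" for e
  proof -
    have "(INF q\<in>?H. qRe (f q) / qRe q) < c + e" using that assms(3) by simp
    then obtain q where "q \<in> ?H" "qRe (f q) / qRe q < c + e"
      unfolding cINF_less_iff[OF ne bdd] by blast
    then show ?thesis by (auto simp: right_half_space_def field_simps)
  qed
  \<comment> \<open>The excess ratio on the real axis controls the whole sector, uniformly over all slices.\<close>
  let ?r = "\<lambda>x. (qRe (f (of_real x)) - c * x) / x"
  have r0: "(?r \<longlongrightarrow> 0) at_top"
    using reg lower almost by (rule excess_ratio_on_axis_tendsto_0)

  have main: "((\<lambda>q. inverse q * f q) \<longlongrightarrow> of_real c) (sector_at_infinity \<gamma>)"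
    "((\<lambda>q. qRe (f q) / qRe q) \<longlongrightarrow> c) (sector_at_infinity \<gamma>)"
    "(slice_deriv f \<longlongrightarrow> of_real c) (sector_at_infinity \<gamma>)"
    if \<gamma>: "0 < \<gamma>" "\<gamma> < 1" for \<gamma>
  proof -
    define M where "M x = 4 * ((1 + 1 / \<gamma>)\<^sup>2 * ?r x)" for x
    have dx: "norm (slice_dx f I (Re z) (Im z) - of_real c) \<le> M (Re z)"
      if "I \<in> imag_units" "Re z > 0" "\<gamma> * norm z < Re z" for I z
      unfolding M_def using slice_dx_bound[OF reg lower that(1) \<gamma>(1) that(2,3)] .
    have "(M \<longlongrightarrow> 4 * ((1 + 1 / \<gamma>)\<^sup>2 * 0)) at_top"
      unfolding M_def by (intro tendsto_intros r0)
    then have M_small: "\<forall>\<^sub>F x in at_top. M x < e" if "e > 0" for e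
      using that by (auto dest: order_tendstoD)

    show "(slice_deriv f \<longlongrightarrow> of_real c) (sector_at_infinity \<gamma>)"
    proof (rule tendstoI)
      fix e :: real assume "e > 0"
      from eventually_sector_at_infinity[OF M_small[OF this] \<gamma>(1)]
      show "\<forall>\<^sub>F q in sector_at_infinity \<gamma>. dist (slice_deriv f q) (of_real c) < e"
      proof eventually_elim
        case (elim q)
        obtain I z where I: "I \<in> imag_units" and q: "q = slice_emb I z" by (rule slice_emb_surj)
        have "Re z > 0" "\<gamma> * norm z < Re z" "M (Re z) < e"
          using elim I by (auto simp: q sector_def right_half_space_def norm_slice_emb)
        then show ?case
          using dx[OF I, of z] slice_deriv_eq_slice_dx[OF reg I, of "Re z" "Im z"]
          by (simp add: q dist_norm)
      qed
    qed

    have small: "\<forall>\<^sub>F q in sector_at_infinity \<gamma>.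
        q \<in> sector \<gamma> \<and> norm (f q - c *\<^sub>R q) \<le> e * norm q" if "e > 0" for e
    proof -
      from M_small[of "e / 2"] that obtain R0 where R0: "\<And>x. x \<ge> R0 \<Longrightarrow> M x < e / 2"
        by (auto simp: eventually_at_top_linorder)
      define R where "R = max R0 1"
      have R: "R > 0" "\<And>x. x \<ge> R \<Longrightarrow> M x < e / 2" using R0 by (auto simp: R_def)
      define K where "K = e / 2 * R + norm (f (of_real R) - of_real (c * R))"
      have "\<forall>\<^sub>F x in at_top. x \<ge> max R (2 * K / e)" by (rule eventually_ge_at_top)
      from eventually_sector_at_infinity[OF this \<gamma>(1)] show ?thesis
      proof eventually_elim
        case (elim q)
        obtain I z where I: "I \<in> imag_units" and q: "q = slice_emb I z" by (rule slice_emb_surj)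
        have z: "R \<le> Re z" "\<gamma> * norm z < Re z" and K: "K \<le> e / 2 * norm z"
          using elim I \<open>e > 0\<close> by (auto simp: q sector_def norm_slice_emb field_simps)
        have "norm (slice_dx f I (Re w) (Im w) - of_real c) \<le> e / 2"
          if "R \<le> Re w" "\<gamma> * norm w < Re w" for w
          using dx[OF I, of w] R(2)[OF that(1)] R(1) that by simp
        from growth_from_slice_dx_bound[OF reg I \<gamma> R(1) this z]
        have "norm (f q - c *\<^sub>R q) \<le> e / 2 * norm z + K"
          by (simp add: q K_def distrib_left)
        then show ?case using K elim by (simp add: q norm_slice_emb[OF I])
      qed
    qed

    have sec: "q \<noteq> 0" "qRe q > 0" "\<gamma> * norm q < qRe q" if "q \<in> sector \<gamma>" for q
      using that by (auto simp: sector_def right_half_space_def)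
    show "((\<lambda>q. inverse q * f q) \<longlongrightarrow> of_real c) (sector_at_infinity \<gamma>)"
    proof (rule tendstoI)
      fix e :: real assume e: "e > 0"
      from small[of "e / 2"] e
      have "\<forall>\<^sub>F q in sector_at_infinity \<gamma>.
        q \<in> sector \<gamma> \<and> norm (f q - c *\<^sub>R q) \<le> e / 2 * norm q" by simp
      then show "\<forall>\<^sub>F q in sector_at_infinity \<gamma>. dist (inverse q * f q) (of_real c) < e"
      proof eventually_elim
        case (elim q)
        then have q: "q \<noteq> 0" using sec by blast
        have "inverse q * f q - of_real c = inverse q * (f q - c *\<^sub>R q)"
          using q by (simp add: right_diff_distrib mult_of_real_quat[symmetric] mult.assoc[symmetric])
        then have "dist (inverse q * f q) (of_real c) = norm (f q - c *\<^sub>R q) / norm q"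
          by (simp add: dist_norm norm_mult norm_inverse divide_inverse)
        also have "\<dots> \<le> e / 2" using elim q by (simp add: field_simps)
        finally show ?case using e by simp
      qed
    qed
    show "((\<lambda>q. qRe (f q) / qRe q) \<longlongrightarrow> c) (sector_at_infinity \<gamma>)"
    proof (rule tendstoI)
      fix e :: real assume e: "e > 0"
      \<comment> \<open>The factor \<open>\<gamma>\<close> absorbs the passage from \<open>norm q\<close> to \<open>qRe q\<close>.\<close>
      from small[of "e * \<gamma>"] e \<gamma>
      have "\<forall>\<^sub>F q in sector_at_infinity \<gamma>.
        q \<in> sector \<gamma> \<and> norm (f q - c *\<^sub>R q) \<le> e * \<gamma> * norm q" by simp
      then show "\<forall>\<^sub>F q in sector_at_infinity \<gamma>. dist (qRe (f q) / qRe q) c < e"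
      proof eventually_elim
        case (elim q)
        note q = sec[OF conjunct1[OF elim]]
        have "\<bar>qRe (f q) - c * qRe q\<bar> \<le> norm (f q - c *\<^sub>R q)"
          using Cauchy_Schwarz_ineq2[of "f q - c *\<^sub>R q" 1] by (simp add: inner_quat_def)
        also have "\<dots> \<le> e * (\<gamma> * norm q)" using elim by (simp add: mult.assoc)
        also have "\<dots> < e * qRe q" using e q by simp
        finally have "\<bar>qRe (f q) - c * qRe q\<bar> / qRe q < e" using q by (simp add: field_simps)
        moreover have "qRe (f q) / qRe q - c = (qRe (f q) - c * qRe q) / qRe q"
          using q by (simp add: field_simps)
        ultimately show ?case using q by (simp add: dist_norm)
      qed
    qed
  qed
  show ?thesis
    using c0 lower main by auto
qed

end
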